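(* Let $M$ be a one-sided bipartite graph matroid limit on the ground set $[m]\times\{1,2,3,\dots\}$, with average rank $\rho$, realization size $\kappa$ and realization rank $\alpha$. Let $C$ be a circuit of $M$ with signature $(k,\ell)$. Then $$\ell\le \alpha-\rho\cdot\kappa+1 .$$
   Context: $\mathbb N$ includes $0$ and $[n]=\{1,\dots,n\}$. Fix $m$. A one-sided bipartite graph matroid sequence is a sequence of matroids $(M_\nu)_{\nu\in\mathbb N}$, with $M_\nu$ on the ground set $E_\nu=[m]\times[\nu]$, such that (a) $M_\nu$ is the restriction of $M_{\nu+1}$ to $E_\nu$, i.e. the independent sets of $M_\nu$ are exactly the sets $S\cap E_\nu$ with $S$ independent in $M_{\nu+1}$; (b) the group $\mathfrak S(m)\times\mathfrak S(\nu)$, acting by $(\sigma,\tau)(i,j)=(\sigma i,\tau j)$, acts on $M_\nu$ by matroid automorphisms. Its limit $M$ (a one-sided bipartite graph matroid limit) has ground set $\bigcup_\nu E_\nu=[m]\times\{1,2,\dots\}$; its circuits are the circuits of the $M_\nu$; a set is dependent iff it contains a circuit, and independent otherwise; for finite $S\subseteq E_\nu$, $\mathrm{rk}(S)=\mathrm{rk}_{M_\nu}(S)$. The signature of a set $S\subseteq [m]\times\{1,2,\dots\}$ is $(k,\ell)$ where $k=\#\{i: (i,j)\in S \text{ for some } j\}$ and $\ell=\#\{j:(i,j)\in S\text{ for some }i\}$. The growth function is $\delta(\nu)=\mathrm{rk}(E_{\nu+1})-\mathrm{rk}(E_\nu)$, $\nu\in\mathbb N$; it is non-negative and non-increasing.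 The average rank is $\rho=\lim_{\nu\to\infty}\delta(\nu)$. The realization size $\kappa$ and realization rank $\alpha$ are the unique elements of $\mathbb N$ such that $\mathrm{rk}(E_\nu)=(\nu-\kappa)\rho+\alpha$ for all $\nu\ge\kappa$ and $\mathrm{rk}(E_\nu)<(\nu-\kappa)\rho+\alpha$ for all $\nu<\kappa$; in particular $\alpha=\mathrm{rk}(E_\kappa)$. *)

theory Defs
  imports Complex_Main "HOL-Combinatorics.Permutations"
begin

locale matroid =
  fixes E :: "'a set" and indep :: "'a set \<Rightarrow> bool"
  assumes finite_ground: "finite E"
    and indep_subset_ground: "indep X \<Longrightarrow> X \<subseteq> E"
    and indep_empty: "indep {}"
    and indep_subset: "indep X \<Longrightarrow> Y \<subseteq> X \<Longrightarrow> indep Y"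
    and augment: "indep X \<Longrightarrow> indep Y \<Longrightarrow> card X < card Y \<Longrightarrow>
      \<exists>y\<in>Y - X. indep (insert y X)"

definition matroid_circuit :: "'a set \<Rightarrow> ('a set \<Rightarrow> bool) \<Rightarrow> 'a set \<Rightarrow> bool" where
  "matroid_circuit E indep C \<longleftrightarrow> C \<subseteq> E \<and> \<not> indep C \<and> (\<forall>D. D \<subset> C \<longrightarrow> indep D)"

definition matroid_rank :: "('a set \<Rightarrow> bool) \<Rightarrow> 'a set \<Rightarrow> nat" where
  "matroid_rank indep S = Max (card ` {X. X \<subseteq> S \<and> indep X})"

definition matroid_automorphism :: "'a set \<Rightarrow> ('a set \<Rightarrow> bool) \<Rightarrow> ('a \<Rightarrow> 'a) \<Rightarrow> bool" where
  "matroid_automorphism E indep f \<longleftrightarrow>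
     bij_betw f E E \<and> (\<forall>S. S \<subseteq> E \<longrightarrow> (indep (f ` S) \<longleftrightarrow> indep S))"

definition grid :: "nat \<Rightarrow> nat \<Rightarrow> (nat \<times> nat) set" where
  "grid m \<nu> = {1..m} \<times> {1..\<nu>}"

text \<open>\<^term>\<open>M \<nu>\<close> is the independence predicate of the \<open>\<nu>\<close>-th matroid. A limit is represented by
  the sequence it comes from; the notions prefixed with \<open>limit\<close> are those of the limit matroid.\<close>

locale one_sided_bipartite_graph_matroid_sequence =
  fixes m :: nat and M :: "nat \<Rightarrow> (nat \<times> nat) set \<Rightarrow> bool"
  assumes matroid: "\<And>\<nu>. matroid (grid m \<nu>) (M \<nu>)"
    and restriction: "\<And>\<nu>. {X. M \<nu> X} = {S \<inter> grid m \<nu> | S. M (Suc \<nu>) S}"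
    and symmetric: "\<And>\<nu> \<sigma> \<tau>. \<sigma> permutes {1..m} \<Longrightarrow> \<tau> permutes {1..\<nu>} \<Longrightarrow>
      matroid_automorphism (grid m \<nu>) (M \<nu>) (\<lambda>(i, j). (\<sigma> i, \<tau> j))"

definition limit_circuit ::
    "nat \<Rightarrow> (nat \<Rightarrow> (nat \<times> nat) set \<Rightarrow> bool) \<Rightarrow> (nat \<times> nat) set \<Rightarrow> bool" where
  "limit_circuit m M C \<longleftrightarrow> (\<exists>\<nu>. matroid_circuit (grid m \<nu>) (M \<nu>) C)"

text \<open>For finite \<open>S\<close> only. Since each matroid is the restriction of the next one, every \<open>\<nu>\<close> with
  \<open>S \<subseteq> grid m \<nu>\<close> yields the same rank; the least one is merely a choice.\<close>

definition limit_rank ::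
    "nat \<Rightarrow> (nat \<Rightarrow> (nat \<times> nat) set \<Rightarrow> bool) \<Rightarrow> (nat \<times> nat) set \<Rightarrow> nat" where
  "limit_rank m M S = matroid_rank (M (LEAST \<nu>. S \<subseteq> grid m \<nu>)) S"

definition signature :: "(nat \<times> nat) set \<Rightarrow> nat \<times> nat" where
  "signature S = (card {i. \<exists>j. (i, j) \<in> S}, card {j. \<exists>i. (i, j) \<in> S})"

definition growth :: "nat \<Rightarrow> (nat \<Rightarrow> (nat \<times> nat) set \<Rightarrow> bool) \<Rightarrow> nat \<Rightarrow> int" where
  "growth m M \<nu> = int (limit_rank m M (grid m (Suc \<nu>))) - int (limit_rank m M (grid m \<nu>))"

definition average_rank :: "nat \<Rightarrow> (nat \<Rightarrow> (nat \<times> nat) set \<Rightarrow> bool) \<Rightarrow> real" where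
  "average_rank m M = lim (\<lambda>\<nu>. real_of_int (growth m M \<nu>))"

definition realization :: "nat \<Rightarrow> (nat \<Rightarrow> (nat \<times> nat) set \<Rightarrow> bool) \<Rightarrow> nat \<times> nat" where
  "realization m M = (THE (\<kappa>, \<alpha>).
     (\<forall>\<nu>\<ge>\<kappa>. real (limit_rank m M (grid m \<nu>)) = (real \<nu> - real \<kappa>) * average_rank m M + real \<alpha>) \<and>
     (\<forall>\<nu><\<kappa>. real (limit_rank m M (grid m \<nu>)) < (real \<nu> - real \<kappa>) * average_rank m M + real \<alpha>))"

definition realization_size :: "nat \<Rightarrow> (nat \<Rightarrow> (nat \<times> nat) set \<Rightarrow> bool) \<Rightarrow> nat" where
  "realization_size m M = fst (realization m M)"

definition realization_rank :: "nat \<Rightarrow> (nat \<Rightarrow> (nat \<times> nat) set \<Rightarrow> bool) \<Rightarrow> nat" where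
  "realization_rank m M = snd (realization m M)"

end

theory Submission
  imports Defs
begin

text \<open>
  Write \<open>R n\<close> for the rank of \<open>n\<close> columns; by symmetry it does not matter which ones. Once
  \<open>n \<ge> \<kappa>\<close>, every further column raises the rank by exactly \<open>\<rho>\<close>, so after contracting a block \<open>F\<close>
  of \<open>N \<ge> \<kappa>\<close> columns disjoint from \<open>C\<close>, the remaining columns form a direct sum of matroids of rank
  \<open>\<rho>\<close>. A circuit of a matroid becomes a union of circuits after a contraction, and a circuit
  of a direct sum lies in one summand. Hence the part of \<open>C\<close> in each of its \<open>\<ell>\<close> columns is dependent
  after contracting \<open>F\<close>, and \<open>C\<close> has nullity at least \<open>\<ell>\<close> there, whereas its nullity in the
  original matroid is \<open>1\<close>.

  So contracting \<open>F\<close> lowers the rank of \<open>C\<close> by at least \<open>\<ell> - 1\<close>. The drop in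
  rank is monotone in the set by submodularity, and for the full \<open>\<ell>\<close> columns supporting \<open>C\<close> it is
  \<open>R \<ell> + R N - R (N + \<ell>) = R \<ell> - \<rho> \<ell>\<close>. Finally \<open>R n - \<rho> n\<close> is non-decreasing with limit
  \<open>\<alpha> - \<rho> \<kappa>\<close>, as \<open>R\<close> is concave with limiting slope \<open>\<rho>\<close>.

  The proof below speaks of ranks of unions with \<open>F\<close> instead of contractions. The local step is
  \<open>spanned_over_smaller_set\<close>, the count of ranks is \<open>circuit_columns_bound\<close>, and the comparison
  of \<open>R n - \<rho> n\<close> with \<open>\<alpha> - \<rho> \<kappa>\<close> is \<open>excess_le_realization\<close>.
\<close>

section \<open>The rank function of a finite matroid\<close>

context matroid
begin

abbreviation rk :: "'a set \<Rightarrow> nat" where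
  "rk \<equiv> matroid_rank indep"

lemma finite_indep_subsets: "finite {X. X \<subseteq> S \<and> indep X}"
  by (rule finite_subset[of _ "Pow E"]) (use finite_ground indep_subset_ground in auto)

lemma finite_indep: "indep X \<Longrightarrow> finite X"
  using finite_ground indep_subset_ground finite_subset by blast

lemma card_le_rank: "indep X \<Longrightarrow> X \<subseteq> S \<Longrightarrow> card X \<le> rk S"
  unfolding matroid_rank_def using finite_indep_subsets by (intro Max_ge) auto

lemma basis_exists: "\<exists>X\<subseteq>S. indep X \<and> card X = rk S"
proof -
  have "rk S \<in> card ` {X. X \<subseteq> S \<and> indep X}"
    unfolding matroid_rank_def using finite_indep_subsets indep_empty by (intro Max_in) auto
  then show ?thesis by auto
qed

lemma extend_to_basis:
  assumes "indep X" "X \<subseteq> S"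
  shows "\<exists>Y. X \<subseteq> Y \<and> Y \<subseteq> S \<and> indep Y \<and> card Y = rk S"
  using assms
proof (induction "rk S - card X" arbitrary: X rule: less_induct)
  case less
  show ?case
  proof (cases "card X = rk S")
    case True
    then show ?thesis using less.prems by blast
  next
    case False
    then have lt: "card X < rk S" using card_le_rank[OF less.prems] by simp
    obtain B where B: "B \<subseteq> S" "indep B" "card B = rk S" using basis_exists by blast
    obtain y where y: "y \<in> B - X" "indep (insert y X)"
      using augment[OF less.prems(1) B(2)] B(3) lt by auto
    have "card (insert y X) = Suc (card X)"
      using y finite_indep[OF less.prems(1)] by simp
    then have "\<exists>Y. insert y X \<subseteq> Y \<and> Y \<subseteq> S \<and> indep Y \<and> card Y = rk S"
      using y B less.prems lt by (intro less.hyps) auto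
    then show ?thesis by blast
  qed
qed

lemma rank_mono: "A \<subseteq> B \<Longrightarrow> rk A \<le> rk B"
  by (metis basis_exists card_le_rank order_trans)

lemma rank_le_card: "finite A \<Longrightarrow> rk A \<le> card A"
  by (metis basis_exists card_mono)

lemma rank_indep: "indep A \<Longrightarrow> rk A = card A"
  by (meson card_le_rank finite_indep order_refl le_antisym rank_le_card)

lemma rank_submodular: "rk (A \<union> B) + rk (A \<inter> B) \<le> rk A + rk B"
proof -
  obtain X where X: "X \<subseteq> A \<inter> B" "indep X" "card X = rk (A \<inter> B)"
    using basis_exists by blast
  then obtain Y where Y: "X \<subseteq> Y" "Y \<subseteq> A \<union> B" "indep Y" "card Y = rk (A \<union> B)"
    using extend_to_basis[of X "A \<union> B"] by blast
  have fin: "finite Y" using Y finite_indep by blast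
  have "card Y + card X \<le> card ((Y \<inter> A) \<union> (Y \<inter> B)) + card ((Y \<inter> A) \<inter> (Y \<inter> B))"
    using X Y fin by (intro add_mono card_mono) auto
  also have "\<dots> = card (Y \<inter> A) + card (Y \<inter> B)"
    using fin by (subst card_Un_Int) auto
  also have "\<dots> \<le> rk A + rk B"
    using Y by (intro add_mono card_le_rank) (auto intro: indep_subset)
  finally show ?thesis using X Y by simp
qed

lemma rank_Un_Int_le:
  assumes "U \<subseteq> A \<union> B" "I \<subseteq> A \<inter> B"
  shows "rk U + rk I \<le> rk A + rk B"
  using rank_submodular[of A B] rank_mono[OF assms(1)] rank_mono[OF assms(2)] by linarith

lemma rank_insert_spanned_mono:
  assumes "rk (insert e A) = rk A" "A \<subseteq> B"
  shows "rk (insert e B) = rk B"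
proof -
  have "rk (insert e B) + rk A \<le> rk (insert e A) + rk B"
    using assms(2) by (intro rank_Un_Int_le) auto
  then show ?thesis using assms(1) rank_mono[of B "insert e B"] by force
qed

lemma rank_Un_spanned:
  assumes "finite D" "\<And>e. e \<in> D \<Longrightarrow> rk (insert e A) = rk A"
  shows "rk (A \<union> D) = rk A"
  using assms
proof (induction D rule: finite_induct)
  case (insert e D)
  then show ?case using rank_insert_spanned_mono[of e A "A \<union> D"] by simp
qed simp

lemma rank_Un_le_card: "finite T \<Longrightarrow> rk (A \<union> T) \<le> rk A + card T"
  using rank_Un_Int_le[of "A \<union> T" A T "{}"] rank_le_card[of T] by force

lemma circuit_rank:
  assumes "matroid_circuit E indep C"
  shows "Suc (rk C) = card C"
proof -
  have C: "C \<subseteq> E" "\<not> indep C" "\<And>D. D \<subset> C \<Longrightarrow> indep D"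
    using assms by (auto simp: matroid_circuit_def)
  have fin: "finite C" using C finite_ground finite_subset by blast
  obtain e where e: "e \<in> C" using C(2) indep_empty by (cases "C = {}") auto
  have "card (C - {e}) \<le> rk C"
    using e by (intro card_le_rank C(3)) auto
  then have "card C \<le> Suc (rk C)" using e fin by simp
  moreover have "rk C < card C"
  proof (rule ccontr)
    assume "\<not> rk C < card C"
    moreover obtain X where "X \<subseteq> C" "indep X" "card X = rk C" using basis_exists by blast
    ultimately have "X = C" using fin by (metis card_seteq not_less)
    then show False using C \<open>indep X\<close> by simp
  qed
  ultimately show ?thesis by simp
qed

lemma circuit_element_spanned:
  assumes "matroid_circuit E indep C" "e \<in> C"
  shows "rk (insert e (C - {e})) = rk (C - {e})"
proof -
  have "finite C"
    using assms finite_ground finite_subset by (auto simp: matroid_circuit_def)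
  moreover have "rk (C - {e}) = card (C - {e})"
    using assms by (intro rank_indep) (auto simp: matroid_circuit_def)
  ultimately show ?thesis
    using circuit_rank[OF assms(1)] assms(2) by (simp add: insert_absorb)
qed

text \<open>If \<open>Y\<close> has the same rank increment over \<open>F\<close> as over the larger set \<open>G\<close>, then \<open>Y\<close> and
  \<open>G - F\<close> are independent of each other after contracting \<open>F\<close>. So whatever \<open>G\<close> and a part of \<open>Y\<close>
  together span inside \<open>Y\<close> is already spanned by \<open>F\<close> and that part.\<close>

lemma spanned_over_smaller_set:
  assumes "F \<subseteq> G" "insert e X \<subseteq> Y"
    and increments: "rk (G \<union> Y) + rk F = rk (F \<union> Y) + rk G"
    and spanned: "rk (insert e (G \<union> X)) = rk (G \<union> X)"
  shows "rk (insert e (F \<union> X)) = rk (F \<union> X)"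
proof -
  have "rk (G \<union> Y) + rk (insert e (F \<union> X)) \<le> rk (F \<union> Y) + rk (insert e (G \<union> X))"
    using assms(1,2) by (intro rank_Un_Int_le) auto
  moreover have "rk (G \<union> X) + rk F \<le> rk (F \<union> X) + rk G"
    using assms(1) by (intro rank_Un_Int_le) auto
  ultimately have "rk (insert e (F \<union> X)) \<le> rk (F \<union> X)"
    using increments spanned by linarith
  then show ?thesis by (rule antisym) (rule rank_mono, blast)
qed

lemma rank_automorphism:
  assumes f: "matroid_automorphism E indep f" and "S \<subseteq> E"
  shows "rk (f ` S) = rk S"
proof (rule antisym)
  have inj: "inj_on f E" and ind: "\<And>T. T \<subseteq> E \<Longrightarrow> indep (f ` T) \<longleftrightarrow> indep T"
    using f by (auto simp: matroid_automorphism_def bij_betw_def)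
  have card: "card (f ` T) = card T" if "T \<subseteq> S" for T
    using inj that \<open>S \<subseteq> E\<close> by (meson card_image inj_on_subset order_trans)
  obtain X where X: "X \<subseteq> S" "indep X" "card X = rk S" using basis_exists by blast
  have "card (f ` X) \<le> rk (f ` S)"
    using X ind \<open>S \<subseteq> E\<close> by (intro card_le_rank) auto
  then show "rk S \<le> rk (f ` S)" using X card by simp
  obtain Y where Y: "Y \<subseteq> f ` S" "indep Y" "card Y = rk (f ` S)" using basis_exists by blast
  obtain T where T: "T \<subseteq> S" "Y = f ` T" using Y(1) by (auto simp: subset_image_iff)
  have "card T \<le> rk S"
    using T Y ind[of T] \<open>S \<subseteq> E\<close> by (intro card_le_rank) auto
  then show "rk (f ` S) \<le> rk S" using T Y card by simp
qed

end

section \<open>Ranks of sets of columns\<close>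

lemma ex_permutes_image:
  assumes "finite S" "A \<subseteq> S" "B \<subseteq> S" "card A = card B"
  shows "\<exists>p. p permutes S \<and> p ` A = B"
proof -
  have fin: "finite A" "finite B" using assms finite_subset by auto
  obtain f where f: "bij_betw f A B"
    using fin assms(4) finite_same_card_bij[of A B] by auto
  have "card (S - A) = card (S - B)" using assms fin by (simp add: card_Diff_subset)
  then obtain g where g: "bij_betw g (S - A) (S - B)"
    using assms(1) finite_same_card_bij[of "S - A" "S - B"] by auto
  define p where "p x = (if x \<in> A then f x else if x \<in> S then g x else x)" for x
  have A: "bij_betw p A B"
    using f by (rule bij_betw_cong[THEN iffD1, rotated]) (simp add: p_def)
  have "bij_betw p (S - A) (S - B)"
    using g by (rule bij_betw_cong[THEN iffD1, rotated]) (auto simp: p_def)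
  from bij_betw_combine[OF A this] have "bij_betw p S S"
    using assms(2,3) by (simp add: Un_absorb1)
  then have "p permutes S"
    using assms(2) by (intro bij_imp_permutes) (auto simp: p_def)
  then show ?thesis using A by (auto simp: bij_betw_def)
qed

lemma grid_mono: "\<nu> \<le> \<mu> \<Longrightarrow> grid m \<nu> \<subseteq> grid m \<mu>"
  by (auto simp: grid_def)

context one_sided_bipartite_graph_matroid_sequence
begin

abbreviation column_rank :: "nat \<Rightarrow> nat" where
  "column_rank n \<equiv> limit_rank m M (grid m n)"

lemma indep_Suc_iff: "M \<nu> X \<longleftrightarrow> M (Suc \<nu>) X \<and> X \<subseteq> grid m \<nu>"
proof
  assume "M \<nu> X"
  then have "X \<in> {S \<inter> grid m \<nu> | S. M (Suc \<nu>) S}" using restriction[of \<nu>] by blast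
  then show "M (Suc \<nu>) X \<and> X \<subseteq> grid m \<nu>"
    using matroid.indep_subset[OF matroid] by blast
next
  assume "M (Suc \<nu>) X \<and> X \<subseteq> grid m \<nu>"
  then have "X \<in> {S \<inter> grid m \<nu> | S. M (Suc \<nu>) S}" by blast
  then show "M \<nu> X" using restriction[of \<nu>] by blast
qed

lemma indep_restrict_iff:
  assumes "\<nu> \<le> \<mu>"
  shows "M \<nu> X \<longleftrightarrow> M \<mu> X \<and> X \<subseteq> grid m \<nu>"
  using assms
proof (induction \<mu> rule: dec_induct)
  case base
  then show ?case using matroid.indep_subset_ground[OF matroid] by blast
next
  case (step \<mu>)
  then show ?case using indep_Suc_iff[of \<mu> X] grid_mono[of \<nu> \<mu> m] by blast
qed

lemma matroid_rank_restrict: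
  assumes "\<nu> \<le> \<mu>" "S \<subseteq> grid m \<nu>"
  shows "matroid_rank (M \<nu>) S = matroid_rank (M \<mu>) S"
proof -
  have "{X. X \<subseteq> S \<and> M \<nu> X} = {X. X \<subseteq> S \<and> M \<mu> X}"
    using indep_restrict_iff[OF assms(1)] assms(2) by blast
  then show ?thesis by (simp add: matroid_rank_def)
qed

lemma limit_rank_eq:
  assumes "S \<subseteq> grid m \<mu>"
  shows "limit_rank m M S = matroid_rank (M \<mu>) S"
  unfolding limit_rank_def
proof (rule matroid_rank_restrict)
  show "(LEAST \<nu>. S \<subseteq> grid m \<nu>) \<le> \<mu>" using assms by (rule Least_le)
  show "S \<subseteq> grid m (LEAST \<nu>. S \<subseteq> grid m \<nu>)"
    using assms by (rule LeastI[where P = "\<lambda>\<nu>. S \<subseteq> grid m \<nu>"])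
qed

lemma circuit_lift:
  assumes "\<nu> \<le> \<mu>" "matroid_circuit (grid m \<nu>) (M \<nu>) C"
  shows "matroid_circuit (grid m \<mu>) (M \<mu>) C"
  using assms indep_restrict_iff[OF assms(1)] grid_mono[OF assms(1), of m]
  unfolding matroid_circuit_def by blast

lemma rank_columns:
  assumes "J \<subseteq> {1..\<mu>}"
  shows "matroid_rank (M \<mu>) ({1..m} \<times> J) = column_rank (card J)"
proof -
  have le: "card J \<le> \<mu>" using card_mono[OF _ assms] by simp
  obtain p where p: "p permutes {1..\<mu>}" "p ` {1..card J} = J"
    using ex_permutes_image[of "{1..\<mu>}" "{1..card J}" J] assms le by auto
  let ?f = "\<lambda>(i, j). (id i, p j)"
  have "?f ` grid m (card J) = {1..m} \<times> p ` {1..card J}"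
    unfolding grid_def by force
  then have "?f ` grid m (card J) = {1..m} \<times> J" by (simp only: p(2))
  moreover have "matroid_rank (M \<mu>) (?f ` grid m (card J)) = matroid_rank (M \<mu>) (grid m (card J))"
    by (intro matroid.rank_automorphism[OF matroid] symmetric p(1) permutes_id grid_mono le)
  ultimately show ?thesis
    using limit_rank_eq[OF grid_mono[OF le]] by simp
qed

lemma column_rank_mono: "column_rank n \<le> column_rank (Suc n)"
  using matroid.rank_mono[OF matroid, of "grid m n" "grid m (Suc n)" "Suc n"]
    limit_rank_eq[of "grid m n" "Suc n"] limit_rank_eq[of "grid m (Suc n)" "Suc n"]
    grid_mono[of n "Suc n" m] by simp

text \<open>Concavity is submodularity for two sets of \<open>n + 1\<close> columns having \<open>n\<close> columns in common.\<close>

lemma column_rank_concave: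
  "column_rank (Suc (Suc n)) + column_rank n \<le> 2 * column_rank (Suc n)"
proof -
  let ?rk = "matroid_rank (M (Suc (Suc n)))" and ?col = "\<lambda>J. {1..m} \<times> (J :: nat set)"
  let ?A = "{1..Suc n}" and ?B = "insert (Suc (Suc n)) {1..n}"
  have "?rk (?col {1..Suc (Suc n)}) + ?rk (?col {1..n}) \<le> ?rk (?col ?A) + ?rk (?col ?B)"
    by (intro matroid.rank_Un_Int_le[OF matroid]) auto
  moreover have "?rk (?col {1..Suc (Suc n)}) = column_rank (Suc (Suc n))"
    "?rk (?col {1..n}) = column_rank n" "?rk (?col ?A) = column_rank (Suc n)"
    "?rk (?col ?B) = column_rank (Suc n)"
    by (subst rank_columns; force)+
  ultimately show ?thesis by linarith
qed

section \<open>The columns of a circuit\<close>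

text \<open>This is the drop in rank of \<open>C\<close> on contracting \<open>N\<close> columns, bounded by the drop in
  rank of the columns that support \<open>C\<close>. Linearity from \<open>N\<close> on makes these columns independent of
  each other after the contraction.\<close>

lemma circuit_columns_bound:
  assumes C: "limit_circuit m M C" and sig: "signature C = (k, l)"
    and slope: "\<And>n. N \<le> n \<Longrightarrow> column_rank (Suc n) = column_rank n + d"
  shows "column_rank (N + l) + l \<le> column_rank N + column_rank l + 1"
proof -
  obtain \<nu> where \<nu>: "matroid_circuit (grid m \<nu>) (M \<nu>) C"
    using C by (auto simp: limit_circuit_def)
  define \<mu> where "\<mu> = \<nu> + N"
  \<comment> \<open>The \<open>N\<close> columns to be contracted. They lie outside the grid that contains \<open>C\<close>.\<close>
  define K where "K = {\<nu> + 1..\<nu> + N}"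
  define J where "J = {j. \<exists>i. (i, j) \<in> C}"
  define col where "col S = {1..m} \<times> S" for S :: "nat set"
  interpret matroid "grid m \<mu>" "M \<mu>" by (rule matroid)
  have circ: "matroid_circuit (grid m \<mu>) (M \<mu>) C"
    using circuit_lift[OF _ \<nu>] by (simp add: \<mu>_def)
  have Cgrid: "C \<subseteq> grid m \<nu>" using \<nu> by (simp add: matroid_circuit_def)
  then have finC: "finite C" by (rule finite_subset) (simp add: grid_def)
  have J\<nu>: "J \<subseteq> {1..\<nu>}" using Cgrid by (auto simp: J_def grid_def)
  then have finJ: "finite J" by (rule finite_subset) simp
  have cardJ: "card J = l" using sig by (simp add: signature_def J_def)
  have CJ: "C \<subseteq> col J" using Cgrid by (auto simp: col_def J_def grid_def)
  have disj: "K \<inter> J = {}" using J\<nu> by (force simp: K_def)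
  have rk_col: "rk (col S) = column_rank (card S)" if "S \<subseteq> K \<union> J" for S
    unfolding col_def using that J\<nu> by (intro rank_columns) (force simp: K_def \<mu>_def)
  have rk_K: "rk (col (K \<union> S)) = column_rank (N + card S)" if "S \<subseteq> J" for S
  proof -
    have "card (K \<union> S) = card K + card S"
      using that disj finite_subset[OF that finJ] by (intro card_Un_disjoint) (auto simp: K_def)
    then show ?thesis using that by (subst rk_col) (auto simp: K_def)
  qed
  \<comment> \<open>Each chosen element will be spanned by the columns in \<open>K\<close> and the rest of \<open>C\<close> in its own column.\<close>
  obtain i where i: "\<And>j. j \<in> J \<Longrightarrow> (i j, j) \<in> C"
    using bchoice[of J "\<lambda>j i. (i, j) \<in> C"] by (auto simp: J_def)
  define D where "D = (\<lambda>j. (i j, j)) ` J"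
  have D: "D \<subseteq> C" "card D = l"
    using i cardJ by (auto simp: D_def card_image inj_on_def)
  have finD: "finite D" using D finC finite_subset by blast
  have spanned: "rk (insert e (col K \<union> (C - D))) = rk (col K \<union> (C - D))" if "e \<in> D" for e
  proof -
    obtain j where j: "j \<in> J" "e = (i j, j)" using \<open>e \<in> D\<close> by (auto simp: D_def)
    define X where "X = C \<inter> col {j} - {e}"
    have X: "insert e X \<subseteq> col {j}" "X \<subseteq> C - D"
      using i[OF j(1)] CJ j by (auto simp: X_def col_def D_def)
    have "rk (insert e (col K \<union> X)) = rk (col K \<union> X)"
    proof (rule spanned_over_smaller_set[of _ "col (K \<union> (J - {j}))" _ _ "col {j}"])
      show "rk (insert e (col (K \<union> (J - {j})) \<union> X)) = rk (col (K \<union> (J - {j})) \<union> X)"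
      proof (rule rank_insert_spanned_mono[OF circuit_element_spanned[OF circ]])
        show "e \<in> C" using that D by blast
        show "C - {e} \<subseteq> col (K \<union> (J - {j})) \<union> X"
          using CJ by (auto simp: X_def col_def)
      qed
      \<comment> \<open>Column \<open>j\<close> adds rank \<open>d\<close> to \<open>K\<close> and also to \<open>K\<close> with the other columns of \<open>C\<close>.\<close>
      have "col (K \<union> (J - {j})) \<union> col {j} = col (K \<union> J)" "col K \<union> col {j} = col (K \<union> {j})"
        using j by (auto simp: col_def)
      moreover have "rk (col (K \<union> J)) = rk (col (K \<union> (J - {j}))) + d"
      proof -
        have "card J = Suc (card (J - {j}))" using j finJ by (metis card.remove)
        then show ?thesis
          using slope[of "N + card (J - {j})"] by (simp add: rk_K[of J] rk_K[of "J - {j}"])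
      qed
      moreover have "rk (col (K \<union> {j})) = rk (col K) + d"
        using slope[of N] j rk_K[of "{j}"] rk_K[of "{}"] by simp
      ultimately show "rk (col (K \<union> (J - {j})) \<union> col {j}) + rk (col K)
          = rk (col K \<union> col {j}) + rk (col (K \<union> (J - {j})))" by simp
    qed (use X in \<open>auto simp: col_def\<close>)
    then show ?thesis by (rule rank_insert_spanned_mono) (use X in auto)
  qed
  have "rk (col K \<union> C) = rk (col K \<union> (C - D) \<union> D)"
    using D by (intro arg_cong[of _ _ rk]) auto
  also have "\<dots> = rk (col K \<union> (C - D))" using finD spanned by (rule rank_Un_spanned)
  also have "\<dots> \<le> rk (col K) + card (C - D)" using finC by (intro rank_Un_le_card) simp
  finally have "rk (col K \<union> C) + l \<le> column_rank N + card C"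
    using D finD card_mono[OF finC D(1)] rk_K[of "{}"] by (simp add: card_Diff_subset)
  moreover have "rk (col (K \<union> J)) + rk C \<le> rk (col K \<union> C) + rk (col J)"
    using CJ by (intro rank_Un_Int_le) (auto simp: col_def)
  ultimately show ?thesis
    using circuit_rank[OF circ] rk_K[of J] rk_col[of J] by (simp add: cardJ)
qed

end

section \<open>Average rank and realization\<close>

text \<open>The differences of \<open>R\<close> are non-increasing natural numbers, so they reach a least value \<open>d\<close>
  and stay there.\<close>

lemma concave_eventually_linear:
  fixes R :: "nat \<Rightarrow> nat"
  assumes mono: "\<And>n. R n \<le> R (Suc n)"
    and concave: "\<And>n. R (Suc (Suc n)) + R n \<le> 2 * R (Suc n)"
  obtains d N where "\<And>n. R n + d \<le> R (Suc n)" "\<And>n. N \<le> n \<Longrightarrow> R (Suc n) = R n + d"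
proof -
  define g where "g n = R (Suc n) - R n" for n
  have R_Suc: "R (Suc n) = R n + g n" for n using mono[of n] by (simp add: g_def)
  have "g (Suc n) \<le> g n" for n
    using concave[of n] R_Suc[of n] R_Suc[of "Suc n"] by linarith
  then have anti: "g n' \<le> g n" if "n \<le> n'" for n n'
    using lift_Suc_antimono_le[of g n n'] that by blast
  obtain N where N: "\<And>n. g N \<le> g n"
    using ex_has_least_nat[of "\<lambda>_. True" 0 g] by auto
  show thesis
  proof (rule that[of "g N" N])
    show "R n + g N \<le> R (Suc n)" for n using N[of n] R_Suc[of n] by linarith
    show "R (Suc n) = R n + g N" if "N \<le> n" for n
      using N[of n] anti[OF that] R_Suc[of n] by linarith
  qed
qed

lemma linear_from:
  fixes R :: "nat \<Rightarrow> nat"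
  assumes "\<And>n. N \<le> n \<Longrightarrow> R (Suc n) = R n + d"
  shows "R (N + j) = R N + d * j"
  by (induction j) (use assms in auto)

text \<open>Here \<open>d\<close> is the average rank, and the sequence \<open>R n - d n\<close> is non-decreasing and eventually
  constant. The realization size is the first index at which it takes its final value, which is
  therefore the right-hand side.\<close>

lemma excess_le_realization:
  fixes m :: nat and M
  defines "R \<equiv> \<lambda>n. limit_rank m M (grid m n)"
  assumes slope_le: "\<And>n. R n + d \<le> R (Suc n)"
    and slope: "\<And>n. N \<le> n \<Longrightarrow> R (Suc n) = R n + d"
  shows "real (R n) - real d * real n
    \<le> real (realization_rank m M) - average_rank m M * real (realization_size m M)"
proof -
  have R_eq: "limit_rank m M (grid m n) = R n" for n by (simp add: R_def)
  have "(\<lambda>n. real_of_int (growth m M n)) \<longlonglongrightarrow> real d"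
  proof (rule tendsto_eventually)
    show "\<forall>\<^sub>F n in sequentially. real_of_int (growth m M n) = real d"
      unfolding eventually_sequentially
      using slope by (intro exI[of _ N]) (simp add: growth_def R_def)
  qed
  then have avg: "average_rank m M = real d"
    unfolding average_rank_def by (rule limI)
  define h where "h n = real (R n) - real d * real n" for n
  have "h n \<le> h (Suc n)" for n
    using slope_le[of n] by (simp add: h_def algebra_simps flip: of_nat_add of_nat_mult)
  then have h_mono: "h n \<le> h n'" if "n \<le> n'" for n n'
    using lift_Suc_mono_le[of h n n'] that by blast
  have h_const: "h n = h N" if n: "N \<le> n" for n
  proof -
    obtain j where "n = N + j" using le_Suc_ex[OF n] by auto
    moreover have "R (N + j) = R N + d * j" by (rule linear_from) (rule slope)
    ultimately show ?thesis by (simp add: h_def algebra_simps)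
  qed
  have h_le: "h n \<le> h N" for n
    using h_mono[of n N] h_const[of n] by (cases "n \<le> N") auto
  define \<kappa> where "\<kappa> = (LEAST n. h n = h N)"
  have \<kappa>: "h \<kappa> = h N" unfolding \<kappa>_def by (rule LeastI) simp
  have below: "h n < h N" if "n < \<kappa>" for n
    using not_less_Least[of n "\<lambda>n. h n = h N"] that h_le[of n] by (auto simp: \<kappa>_def less_le)
  have above: "h n = h N" if "\<kappa> \<le> n" for n
    using h_mono[OF that] h_le[of n] \<kappa> by simp
  have "realization m M = (\<kappa>, R \<kappa>)"
    unfolding realization_def avg R_eq
  proof (rule the_equality, goal_cases)
    case 1
    have "real (R n) = (real n - real \<kappa>) * real d + real (R \<kappa>)" if "\<kappa> \<le> n" for n
      using above[OF that] \<kappa> by (simp add: h_def algebra_simps)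
    moreover have "real (R n) < (real n - real \<kappa>) * real d + real (R \<kappa>)" if "n < \<kappa>" for n
      using below[OF that] \<kappa> by (simp add: h_def algebra_simps)
    ultimately show ?case unfolding prod.case by blast
  next
    case (2 p)
    obtain \<kappa>' \<alpha>' where p: "p = (\<kappa>', \<alpha>')" by force
    have eq: "real (R n) = (real n - real \<kappa>') * real d + real \<alpha>'" if "\<kappa>' \<le> n" for n
      using 2 p that by auto
    have lt: "real (R n) < (real n - real \<kappa>') * real d + real \<alpha>'" if "n < \<kappa>'" for n
      using 2 p that by auto
    have \<alpha>': "\<alpha>' = R \<kappa>'" using eq[of \<kappa>'] by simp
    have h': "h n = h \<kappa>'" if "\<kappa>' \<le> n" for n
      using eq[OF that] \<alpha>' by (simp add: h_def algebra_simps)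
    have h'_lt: "h n < h \<kappa>'" if "n < \<kappa>'" for n
      using lt[OF that] \<alpha>' by (simp add: h_def algebra_simps)
    have hN: "h \<kappa>' = h N"
      using h'[of "max N \<kappa>'"] h_const[of "max N \<kappa>'"] by simp
    have "\<kappa>' = \<kappa>"
      using below[of \<kappa>'] h'_lt[of \<kappa>] \<kappa> hN by (metis less_irrefl linorder_neqE_nat)
    then show ?case using p \<alpha>' by simp
  qed
  then show "real (R n) - real d * real n
      \<le> real (realization_rank m M) - average_rank m M * real (realization_size m M)"
    using h_le[of n] \<kappa> by (simp add: realization_rank_def realization_size_def avg h_def)
qed

theorem theorem4p3:
  fixes m k l :: nat
    and M :: "nat \<Rightarrow> (nat \<times> nat) set \<Rightarrow> bool"
    and C :: "(nat \<times> nat) set"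
  assumes "one_sided_bipartite_graph_matroid_sequence m M"
    and "limit_circuit m M C"
    and "signature C = (k, l)"
  shows "real l \<le> real (realization_rank m M) - average_rank m M * real (realization_size m M) + 1"
proof -
  interpret one_sided_bipartite_graph_matroid_sequence m M by fact
  obtain d N where slope_le: "\<And>n. column_rank n + d \<le> column_rank (Suc n)"
    and slope: "\<And>n. N \<le> n \<Longrightarrow> column_rank (Suc n) = column_rank n + d"
    using concave_eventually_linear[of column_rank] column_rank_mono column_rank_concave by metis
  have "column_rank (N + l) + l \<le> column_rank N + column_rank l + 1"
    using circuit_columns_bound[OF assms(2,3) slope] .
  moreover have "column_rank (N + l) = column_rank N + d * l"
    by (rule linear_from) (rule slope)
  ultimately have "d * l + l \<le> column_rank l + 1" by linarith
  then have "real d * real l + real l \<le> real (column_rank l) + 1"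
    by (metis of_nat_1 of_nat_add of_nat_le_iff of_nat_mult)
  then show ?thesis
    using excess_le_realization[of m M d N l, OF slope_le slope] by linarith
qed

end
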